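(* Let $m,n\ge 2$ be integers and let $p_1,\dots,p_m>0$ with $\sum_{i=1}^m p_i=1$ be the symbol probabilities of a Bernoulli source such that $p_{i_0}\ne 1/m$ for some $i_0$. Then there exist constants $c>0$ and $N_0$ (depending only on $n$ and $p_1,\dots,p_m$) such that every decipherable word-based code from the source alphabet $\{a_1,\dots,a_m\}$ to the output alphabet $\{b_1,\dots,b_n\}$ that is uniform on the output (all words $\phi(A_j)$ have the same length) and has average delay $\bar N\ge N_0$ has redundancy $$R\ge c\,\bar N^{-1}.$$
   Context: A Bernoulli source produces independent symbols from the input alphabet $\{a_1,\dots,a_m\}$ with probabilities $p_1,\dots,p_m$; its entropy is $H=-\sum_{i=1}^m p_i\log_2 p_i$. A message is an infinite sequence of input symbols. For a word $A=a_{i_1}\cdots a_{i_k}$, $|A|=k$ is its length and $p(A)=p_{i_1}\cdots p_{i_k}$. A word-based code consists of a finite set of distinct nonempty words $A_1,A_2,\dots$ over the input alphabet such that every message can be uniquely represented as an infinite concatenation of words $A_j$ (in particular, the set is prefix-free and every message begins with one of its words), together with a map $\phi$ assigning to each $A_j$ a word $\phi(A_j)$ over the output alphabet $\{b_1,\dots,b_n\}$. The code is decipherable if $\phi(A_{i_1})\cdots\phi(A_{i_s})=\phi(A_{j_1})\cdots\phi(A_{j_t})$ always implies $s=t$ and $i_k=j_k$ for $k=1,\dots,s$. Average delay: $\bar N=\sum_j p(A_j)|A_j|$. Redundancy: $R=\bar N^{-1}\sum_j p(A_j)|\phi(A_j)|-H/\log_2 n$. *)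

theory Defs
  imports Complex_Main "HOL-Library.Stream"
begin

text \<open>
  The input alphabet is \<open>{1..m}\<close> and the output alphabet \<open>{1..n}\<close>; words are lists and
  messages are streams. The symbol probabilities \<open>p i\<close> matter only for \<open>i \<in> {1..m}\<close>.
\<close>

definition word_prob :: "(nat \<Rightarrow> real) \<Rightarrow> nat list \<Rightarrow> real" where
  "word_prob p A = prod_list (map p A)"

definition source_entropy :: "nat \<Rightarrow> (nat \<Rightarrow> real) \<Rightarrow> real" where
  "source_entropy m p = - (\<Sum>i\<in>{1..m}. p i * log 2 (p i))"

text \<open>
  The condition \<open>[] \<notin> W\<close> also guarantees that \<^const>\<open>flat\<close> really is infinite concatenation
  on sequences of words from \<open>W\<close>.
\<close>

definition word_based_code ::
    "nat \<Rightarrow> nat \<Rightarrow> nat list set \<Rightarrow> (nat list \<Rightarrow> nat list) \<Rightarrow> bool" where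
  "word_based_code m n W \<phi> \<longleftrightarrow>
     finite W \<and> [] \<notin> W \<and> W \<subseteq> lists {1..m} \<and>
     (\<forall>x\<in>streams {1..m}. \<exists>!ws. ws \<in> streams W \<and> flat ws = x) \<and>
     (\<forall>A\<in>W. \<phi> A \<in> lists {1..n})"

definition decipherable :: "nat list set \<Rightarrow> (nat list \<Rightarrow> nat list) \<Rightarrow> bool" where
  "decipherable W \<phi> \<longleftrightarrow>
     (\<forall>us\<in>lists W. \<forall>vs\<in>lists W. concat (map \<phi> us) = concat (map \<phi> vs) \<longrightarrow> us = vs)"

definition uniform_on_output :: "nat list set \<Rightarrow> (nat list \<Rightarrow> nat list) \<Rightarrow> bool" where
  "uniform_on_output W \<phi> \<longleftrightarrow> (\<exists>l. \<forall>A\<in>W. length (\<phi> A) = l)"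

definition average_delay :: "(nat \<Rightarrow> real) \<Rightarrow> nat list set \<Rightarrow> real" where
  "average_delay p W = (\<Sum>A\<in>W. word_prob p A * real (length A))"

definition redundancy ::
    "nat \<Rightarrow> nat \<Rightarrow> (nat \<Rightarrow> real) \<Rightarrow> nat list set \<Rightarrow> (nat list \<Rightarrow> nat list) \<Rightarrow> real" where
  "redundancy m n p W \<phi> =
     inverse (average_delay p W) * (\<Sum>A\<in>W. word_prob p A * real (length (\<phi> A)))
       - source_entropy m p / log 2 (real n)"

end

theory Submission
  imports Defs "HOL-Library.Sublist"
begin

text \<open>
  Let \<open>l\<close> be the common output length, \<open>K = n ^ l\<close> and \<open>q A = p(A) * K\<close>. As the word
  entropy is \<open>N H\<close> with \<open>N\<close> the average delay, \<open>N R ln n\<close> is the sum of \<open>p(A) ln (q A)\<close> over the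
  code words. There are at most \<open>K\<close> of them, so \<open>ln x \<ge> 1 - 1/x + (1 - 1/sqrt x)\<^sup>2\<close> bounds this
  below by a constant times the total probability of the code words with \<open>\<bar>q A - 1\<bar> \<ge> \<epsilon>\<close>.
  That probability is bounded away from 0: follow the code tree to a point where \<open>q\<close> is bounded
  above. Since \<open>q\<close> decays geometrically along paths, within boundedly many further steps there is a
  bad code word, a subtree with \<open>q \<le> 1 - \<epsilon>\<close> throughout, or a node all of whose children are code
  words. Two of these children have probabilities in the ratio of the largest to the smallest symbol
  probability, so they cannot both satisfy \<open>\<bar>q - 1\<bar> < \<epsilon>\<close>.
\<close>

section \<open>Code trees\<close>

definition extensions :: "'a list set \<Rightarrow> 'a list \<Rightarrow> 'a list set" where
  "extensions W B = {A \<in> W. prefix B A}"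

text \<open>A derivation is the subtree of the code tree below \<open>B\<close>, with every branch
  ending in a code word. Rule induction then carries facts from the code words up to the
  root.\<close>

inductive code_node :: "'a set \<Rightarrow> 'a list set \<Rightarrow> 'a list \<Rightarrow> bool"
  for S :: "'a set" and W :: "'a list set" where
  leaf: "B \<in> W \<Longrightarrow> code_node S W B"
| branch: "B \<in> lists S \<Longrightarrow> B \<notin> W \<Longrightarrow> (\<And>i. i \<in> S \<Longrightarrow> code_node S W (B @ [i])) \<Longrightarrow> code_node S W B"

text \<open>By completeness a non-word without a proper prefix in \<open>W\<close> is itself a
  prefix of a code word, hence no longer than the longest one. So the descent through its children
  stops.\<close>

lemma code_node_no_proper_prefix:
  assumes "finite W" and W: "W \<subseteq> lists S"
    and complete: "\<And>B. B \<in> lists S \<Longrightarrow> \<exists>A\<in>W. prefix A B \<or> prefix B A"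
    and "B \<in> lists S" and "\<And>A. A \<in> W \<Longrightarrow> prefix A B \<Longrightarrow> A = B"
  shows "code_node S W B"
proof -
  define M where "M = Max (length ` W)"
  have M: "length A \<le> M" if "A \<in> W" for A
    using that assms(1) unfolding M_def by simp
  show ?thesis using assms(4,5)
  \<comment> \<open>For a non-word only \<open>length B \<le> M\<close> is derived below; the
    \<open>Suc\<close> makes the measure drop even at length \<open>M\<close>.\<close>
  proof (induction "Suc M - length B" arbitrary: B rule: less_induct)
    case less
    show ?case
    proof (cases "B \<in> W")
      case True
      then show ?thesis by (rule leaf)
    next
      case False
      obtain A where A: "A \<in> W" "prefix A B \<or> prefix B A"
        using complete[OF less.prems(1)] by blast
      then have "prefix B A" using less.prems(2) by blast
      then have len: "length B \<le> M" using M[OF A(1)] prefix_length_le by fastforce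
      show ?thesis
      proof (rule branch[OF less.prems(1) False])
        fix i assume "i \<in> S"
        show "code_node S W (B @ [i])"
        proof (rule less.hyps)
          show "B @ [i] \<in> lists S" using less.prems(1) \<open>i \<in> S\<close> by auto
          show "A = B @ [i]" if "A \<in> W" "prefix A (B @ [i])" for A
            using that less.prems(2)[of A] False by (auto simp: prefix_snoc)
        qed (use len in simp)
      qed
    qed
  qed
qed

lemma extensions_branch:
  assumes "W \<subseteq> lists S" "B \<notin> W"
  shows "extensions W B = (\<Union>i\<in>S. extensions W (B @ [i]))"
proof -
  have "\<exists>i\<in>S. prefix (B @ [i]) A" if A: "A \<in> W" "prefix B A" for A
  proof -
    obtain C where C: "A = B @ C" using A(2) by (rule prefixE)
    with A(1) assms(2) obtain i D where "C = i # D" by (cases C) auto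
    then show ?thesis using C A(1) assms(1) by auto
  qed
  moreover have "prefix B A" if "prefix (B @ [i]) A" for A i
    using that by (meson append_prefixD)
  ultimately show ?thesis unfolding extensions_def by blast
qed

lemma sum_extensions_branch:
  fixes g :: "'a list \<Rightarrow> 'b::comm_monoid_add"
  assumes "W \<subseteq> lists S" "B \<notin> W" "finite S" "finite W"
  shows "sum g (extensions W B) = (\<Sum>i\<in>S. sum g (extensions W (B @ [i])))"
proof -
  have "extensions W (B @ [i]) \<inter> extensions W (B @ [j]) = {}" if "i \<noteq> j" for i j
    using that unfolding extensions_def prefix_def by auto
  then show ?thesis
    unfolding extensions_branch[OF assms(1,2)]
    by (intro sum.UNION_disjoint) (use assms in \<open>auto simp: extensions_def\<close>)
qed

locale code_tree =
  fixes S :: "'a set" and W :: "'a list set"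
  assumes finite_S: "finite S" and finite_W: "finite W" and W: "W \<subseteq> lists S"
    and prefix_free: "A \<in> W \<Longrightarrow> B \<in> W \<Longrightarrow> prefix A B \<Longrightarrow> A = B"
    and root: "code_node S W []"
begin

lemma extensions_leaf: "B \<in> W \<Longrightarrow> extensions W B = {B}"
  unfolding extensions_def using prefix_free by auto

lemma finite_extensions: "finite (extensions W B)"
  unfolding extensions_def using finite_W by simp

lemmas sum_branch = sum_extensions_branch[OF W _ finite_S finite_W]

lemma code_node_lists: "code_node S W B \<Longrightarrow> B \<in> lists S"
  using W by (blast elim: code_node.cases)

lemma code_node_child: "code_node S W B \<Longrightarrow> B \<notin> W \<Longrightarrow> i \<in> S \<Longrightarrow> code_node S W (B @ [i])"
  by (erule code_node.cases) blast+

text \<open>Replacing \<open>F\<close> at a node by its values at the children keeps the sum, so the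
  sum over the leaves below \<open>B\<close> collapses to \<open>B\<close>. This serves both
  probability and entropy.\<close>

lemma sum_extensions_harmonic:
  fixes F :: "'a list \<Rightarrow> 'b::comm_monoid_add"
  assumes "code_node S W B" and "\<And>B. B \<in> lists S \<Longrightarrow> F B = (\<Sum>i\<in>S. F (B @ [i]))"
  shows "sum F (extensions W B) = F B"
  using assms(1)
proof induction
  case (leaf B)
  then show ?case by (simp add: extensions_leaf)
next
  case (branch B)
  then show ?case using assms(2)[of B] by (simp add: sum_branch)
qed

lemma extensions_Nil: "extensions W [] = W"
  unfolding extensions_def by simp

end

text \<open>Messages ending in a constant tail suffice: existence of a parse makes every finite word
  comparable with a code word, and uniqueness makes \<open>W\<close> prefix-free.\<close>

lemma code_tree_word_based_code:
  assumes code: "word_based_code m n W \<phi>" and m: "m \<ge> 1"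
  shows "code_tree {1..m} W"
proof -
  have fin: "finite W" and ne: "[] \<notin> W" and W: "W \<subseteq> lists {1..m}"
    and ex: "\<And>x. x \<in> streams {1..m} \<Longrightarrow> \<exists>!ws. ws \<in> streams W \<and> flat ws = x"
    using code unfolding word_based_code_def by auto
  have tail: "sconst 1 \<in> streams {1..m}" using m by (simp add: streams_iff_sset)
  have flat: "flat (A ## ws) = A @- flat ws" if "A \<in> W" for A ws
    using ne that by (metis flat_unfold stream.sel)
  have comp: "\<exists>A\<in>W. prefix A B \<or> prefix B A" if B: "B \<in> lists {1..m}" for B
  proof -
    have "B @- sconst 1 \<in> streams {1..m}" using B tail by (intro shift_streams) auto
    then obtain ws where ws: "ws \<in> streams W" "flat ws = B @- sconst 1" using ex by blast
    obtain A ws' where A: "ws = A ## ws'" by (cases ws)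
    have AW: "A \<in> W" using ws(1) A by (auto elim: streams.cases)
    have eq: "A @- flat ws' = B @- sconst 1" using ws(2) A flat[OF AW] by simp
    have "take (min (length A) (length B)) A = take (min (length A) (length B)) B"
      using arg_cong[OF eq, of "stake (min (length A) (length B))"] by (simp add: stake_shift)
    then have "prefix A B \<or> prefix B A"
      by (metis min.cobounded1 min.cobounded2 min_def take_all_iff take_is_prefix)
    with AW show ?thesis by blast
  qed
  have pf: "A = B" if A: "A \<in> W" and B: "B \<in> W" and AB: "prefix A B" for A B
  proof -
    obtain C where C: "B = A @ C" using AB by (rule prefixE)
    have Cs: "C @- sconst 1 \<in> streams {1..m}"
      using B W C tail by (intro shift_streams) auto
    obtain us where us: "us \<in> streams W" "flat us = C @- sconst 1" using ex[OF Cs] by blast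
    obtain vs where vs: "vs \<in> streams W" "flat vs = sconst 1" using ex[OF tail] by blast
    \<comment> \<open>Two parses of \<open>B\<close> followed by the constant tail, one starting
      with \<open>A\<close> and one with \<open>B\<close>; uniqueness identifies their
      heads.\<close>
    have "flat (A ## us) = flat (B ## vs)" using us vs C flat[OF A] flat[OF B] by simp
    moreover have "flat (B ## vs) \<in> streams {1..m}"
      unfolding flat[OF B] vs(2) using B W tail by (intro shift_streams) auto
    moreover have "A ## us \<in> streams W" "B ## vs \<in> streams W" using us vs A B by auto
    ultimately have "A ## us = B ## vs" using ex by blast
    then show ?thesis by simp
  qed
  have "code_node {1..m} W []"
    by (rule code_node_no_proper_prefix[OF fin W comp]) (use ne in auto)
  then show ?thesis using fin W pf by unfold_locales auto
qed

section \<open>Atypical code words\<close>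

locale source_code = code_tree S W for S :: "nat set" and W +
  fixes p :: "nat \<Rightarrow> real"
  assumes p_pos: "i \<in> S \<Longrightarrow> p i > 0" and p_sum: "sum p S = 1"
begin

section \<open>Probability and entropy of the code words\<close>

lemma word_prob_pos: "B \<in> lists S \<Longrightarrow> word_prob p B > 0"
  unfolding word_prob_def by (induction B) (auto simp: p_pos)

lemma word_prob_snoc: "word_prob p (B @ [i]) = word_prob p B * p i"
  unfolding word_prob_def by simp

lemma sum_word_prob_extensions:
  assumes "code_node S W B"
  shows "sum (word_prob p) (extensions W B) = word_prob p B"
  using assms
  by (rule sum_extensions_harmonic) (simp add: word_prob_snoc p_sum flip: sum_distrib_left)

lemma sum_word_prob: "sum (word_prob p) W = 1"
  using sum_word_prob_extensions[OF root] by (simp add: extensions_Nil word_prob_def)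

lemma word_prob_extension_le:
  assumes "code_node S W B" "A \<in> extensions W B"
  shows "word_prob p A \<le> word_prob p B"
proof -
  have "word_prob p A \<le> sum (word_prob p) (extensions W B)"
  proof (rule member_le_sum[OF assms(2) _ finite_extensions])
    fix C assume "C \<in> extensions W B - {A}"
    then have "C \<in> lists S" using W unfolding extensions_def by blast
    then show "0 \<le> word_prob p C" using word_prob_pos by (simp add: less_imp_le)
  qed
  then show ?thesis using sum_word_prob_extensions[OF assms(1)] by simp
qed

text \<open>A random letter changes the log-probability by \<open>h\<close> on average, so
  subtracting \<open>h\<close> per letter makes \<open>F\<close> harmonic, with
  \<open>F [] = 0\<close>. This is an identity of Wald type for a stopped sum.\<close>

lemma word_entropy:
  "(\<Sum>A\<in>W. word_prob p A * ln (word_prob p A)) = (\<Sum>i\<in>S. p i * ln (p i)) * average_delay p W"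
proof -
  define h where "h = (\<Sum>i\<in>S. p i * ln (p i))"
  define F where "F B = word_prob p B * (ln (word_prob p B) - h * real (length B))" for B
  have "F B = (\<Sum>i\<in>S. F (B @ [i]))" if B: "B \<in> lists S" for B
  proof -
    have "(\<Sum>i\<in>S. F (B @ [i])) = (\<Sum>i\<in>S. p i * (F B - word_prob p B * h)
        + word_prob p B * (p i * ln (p i)))"
      unfolding F_def
      by (intro sum.cong refl)
        (simp add: word_prob_snoc ln_mult_pos word_prob_pos[OF B] p_pos algebra_simps)
    also have "\<dots> = F B"
      by (simp add: sum.distrib p_sum h_def flip: sum_distrib_left sum_distrib_right)
    finally show ?thesis by simp
  qed
  then have "sum F W = F []"
    using sum_extensions_harmonic[OF root, of F] by (simp add: extensions_Nil)
  then show ?thesis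
    unfolding F_def average_delay_def h_def[symmetric]
    by (simp add: word_prob_def algebra_simps sum_subtractf sum_distrib_left)
qed

lemma average_delay_ge_1:
  assumes "[] \<notin> W"
  shows "average_delay p W \<ge> 1"
proof -
  have "sum (word_prob p) W \<le> average_delay p W"
    unfolding average_delay_def
  proof (rule sum_mono)
    fix A assume A: "A \<in> W"
    then have "real (length A) \<ge> 1" using assms by (cases A) auto
    moreover have "word_prob p A > 0" using word_prob_pos A W by blast
    ultimately show "word_prob p A \<le> word_prob p A * real (length A)" by simp
  qed
  then show ?thesis by (simp add: sum_word_prob)
qed

text \<open>\<open>K\<close> will be the number of output words of the common length, so the test
  compares a word probability with the uniform value \<open>1 / K\<close>. The mass is absolute, not
  conditional on reaching \<open>B\<close>.\<close>

definition atypical_mass :: "real \<Rightarrow> real \<Rightarrow> nat list \<Rightarrow> real" where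
  "atypical_mass K e B =
    (\<Sum>A\<in>extensions W B. if \<bar>word_prob p A * K - 1\<bar> \<ge> e then word_prob p A else 0)"

lemma atypical_mass_nonneg: "atypical_mass K e B \<ge> 0"
  unfolding atypical_mass_def extensions_def
  by (rule sum_nonneg) (use word_prob_pos W in \<open>auto intro: less_imp_le\<close>)

lemma atypical_mass_branch:
  "B \<notin> W \<Longrightarrow> atypical_mass K e B = (\<Sum>i\<in>S. atypical_mass K e (B @ [i]))"
  unfolding atypical_mass_def by (rule sum_branch)

lemma atypical_mass_child_le:
  "B \<notin> W \<Longrightarrow> i \<in> S \<Longrightarrow> atypical_mass K e (B @ [i]) \<le> atypical_mass K e B"
  using member_le_sum[of i S "\<lambda>i. atypical_mass K e (B @ [i])"] atypical_mass_nonneg finite_S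
  by (simp add: atypical_mass_branch)

lemma atypical_mass_leaf:
  "B \<in> W \<Longrightarrow> \<bar>word_prob p B * K - 1\<bar> \<ge> e \<Longrightarrow> atypical_mass K e B = word_prob p B"
  unfolding atypical_mass_def by (simp add: extensions_leaf)

section \<open>Lower bound for the mass of atypical words\<close>

context
  fixes i j :: nat and e K :: real
  assumes i: "i \<in> S" and j: "j \<in> S"
    and p_le: "\<And>k. k \<in> S \<Longrightarrow> p k \<le> p i" and p_ge: "\<And>k. k \<in> S \<Longrightarrow> p j \<le> p k"
    and e: "0 < e" "e < 1" "p j * (1 + e) \<le> p i * (1 - e)" and K: "K > 0"
begin

lemma p_j_le_1: "p j \<le> 1"
proof -
  have "p j \<le> sum p S"
    by (rule member_le_sum[OF j _ finite_S]) (simp add: p_pos less_imp_le)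
  then show ?thesis by (simp add: p_sum)
qed

text \<open>Within \<open>D\<close> levels \<open>word_prob p B * K\<close> falls to
  \<open>1 - e\<close>, since each letter has probability at most \<open>p i\<close>. Descend
  through non-words: either that level is reached and everything below is atypical, or all children
  are words and one of them is atypical. Each level costs at most a factor \<open>p j\<close>, and
  the last child accounts for the \<open>Suc\<close>.\<close>

lemma atypical_mass_near:
  assumes "code_node S W B" "B \<notin> W" "word_prob p B * K * p i ^ D \<le> 1 - e"
  shows "atypical_mass K e B \<ge> p j ^ Suc D * word_prob p B"
  using assms
proof (induction D arbitrary: B)
  case 0
  have "atypical_mass K e B = sum (word_prob p) (extensions W B)"
    unfolding atypical_mass_def
  proof (rule sum.cong)
    fix A assume "A \<in> extensions W B"
    then have "word_prob p A * K \<le> word_prob p B * K"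
      using word_prob_extension_le 0 K by (simp add: mult_right_mono)
    then show "(if e \<le> \<bar>word_prob p A * K - 1\<bar> then word_prob p A else 0) = word_prob p A"
      using 0 by auto
  qed simp
  then have "atypical_mass K e B = word_prob p B"
    using sum_word_prob_extensions 0 by simp
  moreover have "p j * word_prob p B \<le> 1 * word_prob p B"
    using p_j_le_1 word_prob_pos[OF code_node_lists[OF 0(1)]] by (intro mult_right_mono) auto
  ultimately show ?case by simp
next
  case (Suc D)
  have B: "word_prob p B > 0" using word_prob_pos code_node_lists Suc.prems(1) by blast
  have pj: "p j > 0" "p i > 0" using p_pos i j by auto
  show ?case
  proof (cases "\<exists>k\<in>S. B @ [k] \<notin> W")
    case True
    then obtain k where k: "k \<in> S" "B @ [k] \<notin> W" by blast
    have "word_prob p (B @ [k]) * K * p i ^ D \<le> word_prob p B * K * p i ^ Suc D"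
      using p_le[OF k(1)] B K pj by (simp add: word_prob_snoc mult_right_mono mult_left_mono)
    then have "p j ^ Suc D * word_prob p (B @ [k]) \<le> atypical_mass K e (B @ [k])"
      using Suc.prems k by (intro Suc.IH code_node_child) auto
    moreover have "p j ^ Suc D * (word_prob p B * p j) \<le> p j ^ Suc D * word_prob p (B @ [k])"
      using p_ge[OF k(1)] B pj by (simp add: word_prob_snoc mult_left_mono)
    ultimately show ?thesis
      using atypical_mass_child_le[OF Suc.prems(2) k(1), of K e] by (simp add: mult_ac)
  next
    case False
    \<comment> \<open>The children by \<open>i\<close> and \<open>j\<close> have probabilities in
      the ratio \<open>p i / p j\<close>, at least \<open>(1 + e) / (1 - e)\<close> by the choice of
      \<open>e\<close>; two values strictly between \<open>1 - e\<close> and \<open>1 + e\<close>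
      have a smaller ratio.\<close>
    have "\<exists>k\<in>S. \<bar>word_prob p (B @ [k]) * K - 1\<bar> \<ge> e"
    proof (rule ccontr)
      assume "\<not> ?thesis"
      then have less: "word_prob p B * K * p i < 1 + e" "1 - e < word_prob p B * K * p j"
        using i j by (force simp: word_prob_snoc mult_ac)+
      have "p i * (1 - e) < p i * (word_prob p B * K * p j)"
        using less(2) pj by simp
      also have "\<dots> = p j * (word_prob p B * K * p i)" by simp
      also have "\<dots> < p j * (1 + e)" using less(1) pj by simp
      finally show False using e by simp
    qed
    then obtain k where k: "k \<in> S" "\<bar>word_prob p (B @ [k]) * K - 1\<bar> \<ge> e" by blast
    then have "word_prob p (B @ [k]) \<le> atypical_mass K e B"
      using atypical_mass_leaf[of "B @ [k]" e K] False
        atypical_mass_child_le[OF Suc.prems(2) k(1), of K e] by simp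
    moreover have "word_prob p B * p j \<le> word_prob p (B @ [k])"
      using p_ge[OF k(1)] B by (simp add: word_prob_snoc)
    moreover have "p j ^ Suc D * (word_prob p B * p j) \<le> 1 * (word_prob p B * p j)"
      using p_j_le_1 pj B by (intro mult_right_mono power_le_one) auto
    ultimately show ?thesis by (simp add: mult_ac)
  qed
qed

text \<open>While \<open>word_prob p B * K\<close> is so large that all children stay above
  \<open>1 + e\<close>, the bounds of the children add up, as their probabilities sum to that of
  \<open>B\<close>. Code words met in this phase are atypical. The first other node falls under
  \<open>atypical_mass_near\<close>.\<close>

lemma atypical_mass_lower:
  assumes D: "(1 + e) * p i ^ D \<le> p j * (1 - e)"
    and "code_node S W B" "B \<in> W \<longrightarrow> word_prob p B * K \<ge> 1 + e"
  shows "atypical_mass K e B \<ge> p j ^ Suc D * word_prob p B"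
  using assms(2,3)
proof induction
  case (leaf B)
  have "word_prob p B > 0" using word_prob_pos leaf W by blast
  then have "p j ^ Suc D * word_prob p B \<le> 1 * word_prob p B"
    using p_j_le_1 p_pos[OF j] by (intro mult_right_mono power_le_one) auto
  then show ?case using leaf atypical_mass_leaf[of B e K] by simp
next
  case (branch B)
  have pj: "p j > 0" "p i > 0" using p_pos i j by auto
  have B: "word_prob p B > 0" using word_prob_pos branch by blast
  show ?case
  proof (cases "word_prob p B * K * p j \<le> 1 + e")
    case True
    \<comment> \<open>Here \<open>word_prob p B * K\<close> is at most \<open>(1 + e) / p j\<close>,
      and \<open>D\<close> is large enough to bring this down to \<open>1 - e\<close>.\<close>
    have "p j * (word_prob p B * K * p i ^ D) = word_prob p B * K * p j * p i ^ D" by simp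
    also have "\<dots> \<le> (1 + e) * p i ^ D" using True pj by (intro mult_right_mono) auto
    also note D
    finally have "word_prob p B * K * p i ^ D \<le> 1 - e" using pj by simp
    moreover have "code_node S W B" using branch.hyps by (rule code_node.branch)
    ultimately show ?thesis using \<open>B \<notin> W\<close> by (intro atypical_mass_near)
  next
    case False
    have "p j ^ Suc D * word_prob p (B @ [k]) \<le> atypical_mass K e (B @ [k])" if k: "k \<in> S" for k
    proof (rule branch.IH[OF k], rule impI)
      have "word_prob p B * K * p j \<le> word_prob p B * K * p k"
        using B K p_ge[OF k] by (intro mult_left_mono) auto
      then show "1 + e \<le> word_prob p (B @ [k]) * K"
        using False by (simp add: word_prob_snoc mult_ac)
    qed
    then have "(\<Sum>k\<in>S. p j ^ Suc D * word_prob p (B @ [k])) \<le> atypical_mass K e B"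
      unfolding atypical_mass_branch[OF \<open>B \<notin> W\<close>] by (rule sum_mono)
    then show ?thesis by (simp add: word_prob_snoc p_sum flip: sum_distrib_left)
  qed
qed

end

section \<open>Redundancy\<close>

text \<open>The bound \<open>ln y \<le> y - 1\<close> at \<open>y = 1 / sqrt x\<close>, rewritten so
  that the surplus over the usual \<open>1 - 1 / x\<close> is a square.\<close>

lemma ln_ge_sqrt:
  fixes x :: real
  assumes "x > 0"
  shows "ln x \<ge> 1 - 1 / x + (1 - 1 / sqrt x)\<^sup>2"
proof -
  have "ln (1 / sqrt x) \<le> 1 / sqrt x - 1" using assms by (intro ln_le_minus_one) auto
  then have "ln x \<ge> 2 * (1 - 1 / sqrt x)" using assms by (simp add: ln_div ln_sqrt)
  moreover have "(1 - 1 / sqrt x)\<^sup>2 = 1 - 2 / sqrt x + 1 / x"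
    using assms by (simp add: power2_diff power_divide)
  ultimately show ?thesis by simp
qed

text \<open>Gibbs' inequality with a remainder: the terms \<open>1 - 1 / x\<close> average to
  \<open>1 - card W / K\<close>, which is nonnegative, and the squares left over form a squared
  Hellinger distance to the weight \<open>1 / K\<close>. Each atypical word contributes at least
  \<open>d\<close> times its probability.\<close>

lemma sum_ln_ge_atypical_mass:
  assumes K: "real (card W) \<le> K" "K > 0"
    and d: "\<And>x. x > 0 \<Longrightarrow> \<bar>x - 1\<bar> \<ge> e \<Longrightarrow> d \<le> (1 - 1 / sqrt x)\<^sup>2"
  shows "d * atypical_mass K e [] \<le> (\<Sum>A\<in>W. word_prob p A * ln (word_prob p A * K))"
proof -
  have "d * (if e \<le> \<bar>word_prob p A * K - 1\<bar> then word_prob p A else 0) + word_prob p A - 1 / K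
      \<le> word_prob p A * ln (word_prob p A * K)" if A: "A \<in> W" for A
  proof -
    define q where "q = word_prob p A"
    have q: "q > 0" using word_prob_pos A W unfolding q_def by blast
    define s where "s = (1 - 1 / sqrt (q * K))\<^sup>2"
    have "(if e \<le> \<bar>q * K - 1\<bar> then d else 0) \<le> s"
      unfolding s_def using d[of "q * K"] q K by simp
    then have "q * (if e \<le> \<bar>q * K - 1\<bar> then d else 0) \<le> q * s" using q by simp
    moreover have "q * (1 - 1 / (q * K) + s) \<le> q * ln (q * K)"
      unfolding s_def using ln_ge_sqrt[of "q * K"] q K by simp
    moreover have "q * (1 - 1 / (q * K) + s) = q - 1 / K + q * s"
      using q K by (simp add: field_simps)
    ultimately show ?thesis unfolding q_def[symmetric] by (auto simp: mult_ac)
  qed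
  then have "(\<Sum>A\<in>W. d * (if e \<le> \<bar>word_prob p A * K - 1\<bar> then word_prob p A else 0)
      + word_prob p A - 1 / K) \<le> (\<Sum>A\<in>W. word_prob p A * ln (word_prob p A * K))"
    by (rule sum_mono)
  then have "d * atypical_mass K e [] + 1 - real (card W) / K
      \<le> (\<Sum>A\<in>W. word_prob p A * ln (word_prob p A * K))"
    unfolding atypical_mass_def extensions_Nil
    by (simp add: sum.distrib sum_subtractf sum_word_prob sum_distrib_left)
  moreover have "real (card W) / K \<le> 1" using K by simp
  ultimately show ?thesis by linarith
qed

end

section \<open>Uniform codes and the final constants\<close>

lemma card_uniform_code_le:
  assumes "word_based_code m n W \<phi>" "decipherable W \<phi>" "\<And>A. A \<in> W \<Longrightarrow> length (\<phi> A) = l"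
  shows "card W \<le> n ^ l"
proof -
  have "inj_on \<phi> W"
  proof
    fix A B assume "A \<in> W" "B \<in> W" "\<phi> A = \<phi> B"
    then have "[A] = [B]"
      using assms(2)[unfolded decipherable_def, rule_format, of "[A]" "[B]"] by simp
    then show "A = B" by simp
  qed
  moreover have "\<phi> ` W \<subseteq> {xs. set xs \<subseteq> {1..n} \<and> length xs = l}"
    using assms(1,3) unfolding word_based_code_def by auto
  ultimately have "card W \<le> card {xs. set xs \<subseteq> {1..n} \<and> length xs = l}"
    by (intro card_inj_on_le) (auto intro: finite_lists_length_eq)
  then show ?thesis by (simp add: card_lists_length_eq)
qed

text \<open>The mean output length is \<open>l\<close>, and \<open>l * ln n\<close> is the logarithm
  of \<open>n ^ l\<close>. With \<open>word_entropy\<close>, redundancy becomes a divergence from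
  the constant weight \<open>1 / n ^ l\<close>, per input letter.\<close>

lemma (in source_code) redundancy_uniform:
  assumes "S = {1..m}" "n \<ge> 2" "average_delay p W \<noteq> 0" "\<And>A. A \<in> W \<Longrightarrow> length (\<phi> A) = l"
  shows "redundancy m n p W \<phi> = (\<Sum>A\<in>W. word_prob p A * ln (word_prob p A * real n ^ l))
    / ln (real n) * inverse (average_delay p W)"
proof -
  define N where "N = average_delay p W"
  define h where "h = (\<Sum>i\<in>S. p i * ln (p i))"
  have n: "ln (real n) > 0" using assms(2) by simp
  have len: "(\<Sum>A\<in>W. word_prob p A * real (length (\<phi> A))) = l"
    using assms(4) by (simp add: sum_word_prob flip: sum_distrib_right)
  have ent: "source_entropy m p / log 2 (real n) = - h / ln (real n)"
    unfolding source_entropy_def h_def log_def assms(1) using n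
    by (simp flip: sum_divide_distrib)
  have "(\<Sum>A\<in>W. word_prob p A * ln (word_prob p A * real n ^ l))
      = (\<Sum>A\<in>W. word_prob p A * ln (word_prob p A) + word_prob p A * (l * ln (real n)))"
  proof (rule sum.cong)
    fix A assume "A \<in> W"
    then have "word_prob p A > 0" using word_prob_pos W by blast
    then show "word_prob p A * ln (word_prob p A * real n ^ l) =
        word_prob p A * ln (word_prob p A) + word_prob p A * (l * ln (real n))"
      using assms(2) by (simp add: ln_mult_pos ln_realpow algebra_simps)
  qed simp
  then have sum: "(\<Sum>A\<in>W. word_prob p A * ln (word_prob p A * real n ^ l)) = h * N + l * ln (real n)"
    by (simp add: sum.distrib word_entropy sum_word_prob h_def N_def flip: sum_distrib_right)
  show ?thesis
    unfolding redundancy_def len ent sum N_def[symmetric]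
    using n assms(3) by (simp add: N_def[symmetric] field_simps)
qed

text \<open>As \<open>1 / sqrt x\<close> decreases through 1 at \<open>x = 1\<close>, its distance
  from 1 is smallest at the endpoints \<open>1 - e\<close> and \<open>1 + e\<close>.\<close>

lemma square_dist_inverse_sqrt_lower:
  fixes e :: real
  assumes "0 < e" "e < 1"
  obtains d where "d > 0" "\<And>x. x > 0 \<Longrightarrow> \<bar>x - 1\<bar> \<ge> e \<Longrightarrow> d \<le> (1 - 1 / sqrt x)\<^sup>2"
proof
  define u where "u = 1 / sqrt (1 - e) - 1"
  define v where "v = 1 - 1 / sqrt (1 + e)"
  have uv: "u > 0" "v > 0" unfolding u_def v_def using assms by auto
  then show "min u v ^ 2 > 0" by simp
  fix x :: real assume x: "x > 0" "\<bar>x - 1\<bar> \<ge> e"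
  have "min u v \<le> \<bar>1 - 1 / sqrt x\<bar>"
  proof (cases "x \<ge> 1")
    case True
    then have "1 / sqrt x \<le> 1 / sqrt (1 + e)" using x assms by (intro divide_left_mono) auto
    then show ?thesis unfolding v_def by linarith
  next
    case False
    then have "1 / sqrt (1 - e) \<le> 1 / sqrt x" using x assms by (intro divide_left_mono) auto
    then show ?thesis unfolding u_def by linarith
  qed
  then have "min u v ^ 2 \<le> \<bar>1 - 1 / sqrt x\<bar> ^ 2" using uv by (intro power_mono) auto
  then show "min u v ^ 2 \<le> (1 - 1 / sqrt x)\<^sup>2" by simp
qed

theorem theorem5:
  fixes m n :: nat and p :: "nat \<Rightarrow> real"
  assumes "m \<ge> 2" and "n \<ge> 2"
    and "\<And>i. i \<in> {1..m} \<Longrightarrow> p i > 0"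
    and "(\<Sum>i\<in>{1..m}. p i) = 1"
    and "\<exists>i\<^sub>0\<in>{1..m}. p i\<^sub>0 \<noteq> 1 / real m"
  shows "\<exists>c>0. \<exists>N\<^sub>0::real. \<forall>W \<phi>.
           word_based_code m n W \<phi> \<longrightarrow> decipherable W \<phi> \<longrightarrow> uniform_on_output W \<phi> \<longrightarrow>
           average_delay p W \<ge> N\<^sub>0 \<longrightarrow>
           redundancy m n p W \<phi> \<ge> c * inverse (average_delay p W)"
proof -
  let ?S = "{1..m}"
  have ne: "?S \<noteq> {}" using assms(1) by simp
  obtain i where i: "i \<in> ?S" "\<And>k. k \<in> ?S \<Longrightarrow> p k \<le> p i"
    using Max_in[of "p ` ?S"] Max_ge[of "p ` ?S"] ne by fastforce
  obtain j where j: "j \<in> ?S" "\<And>k. k \<in> ?S \<Longrightarrow> p j \<le> p k"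
    using Min_in[of "p ` ?S"] Min_le[of "p ` ?S"] ne by fastforce
  have pos: "p i > 0" "p j > 0" using assms(3) i j by auto
  have ji: "p j < p i"
  proof (rule ccontr)
    assume "\<not> p j < p i"
    then have eq: "p k = p i" if "k \<in> ?S" for k using i(2) j(2) that by force
    have "(\<Sum>k\<in>?S. p k) = (\<Sum>k\<in>?S. p i)" by (rule sum.cong) (auto intro: eq)
    then have "p i = 1 / real m" using assms(1,4) by (simp add: field_simps)
    then show False using assms(5) eq by auto
  qed
  \<comment> \<open>Two distinct letters of positive probability force \<open>p i < 1\<close>, which
    gives the geometric decay behind \<open>D\<close>.\<close>
  have "sum p {i, j} \<le> sum p ?S"
    by (rule sum_mono2) (use i(1) j(1) assms(3) in \<open>auto intro: less_imp_le\<close>)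
  moreover have "i \<noteq> j" using ji by auto
  ultimately have "p i + p j \<le> 1" using assms(4) by simp
  then have i1: "p i < 1" using pos by simp
  \<comment> \<open>This value solves \<open>p j * (1 + e) = p i * (1 - e)\<close>.\<close>
  define e where "e = (p i - p j) / (p i + p j)"
  have e: "0 < e" "e < 1" "p j * (1 + e) \<le> p i * (1 - e)"
    unfolding e_def using ji pos by (auto simp: field_simps)
  obtain D where "p i ^ D < p j * (1 - e) / (1 + e)"
    using real_arch_pow_inv[of "p j * (1 - e) / (1 + e)" "p i"] i1 e pos by auto
  then have D: "(1 + e) * p i ^ D \<le> p j * (1 - e)" using e by (simp add: field_simps)
  obtain d where d: "d > 0" "\<And>x. x > 0 \<Longrightarrow> \<bar>x - 1\<bar> \<ge> e \<Longrightarrow> d \<le> (1 - 1 / sqrt x)\<^sup>2"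
    using square_dist_inverse_sqrt_lower[OF e(1,2)] by blast
  \<comment> \<open>\<open>p j ^ Suc D\<close> bounds the atypical mass at the root,
    \<open>d\<close> is the gain per unit of that mass, and \<open>ln n\<close> converts units. All
    are fixed before the code is given.\<close>
  define c where "c = d * p j ^ Suc D / ln (real n)"
  have n: "ln (real n) > 0" using assms(2) by simp
  have "c * inverse (average_delay p W) \<le> redundancy m n p W \<phi>"
    if code: "word_based_code m n W \<phi>" and dec: "decipherable W \<phi>"
      and unif: "uniform_on_output W \<phi>" for W \<phi>
  proof -
    interpret code_tree ?S W
      using code assms(1) by (intro code_tree_word_based_code) auto
    interpret source_code ?S W p
      using assms(3,4) by unfold_locales auto
    obtain l where l: "\<And>A. A \<in> W \<Longrightarrow> length (\<phi> A) = l"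
      using unif unfolding uniform_on_output_def by blast
    have nil: "[] \<notin> W" using code unfolding word_based_code_def by blast
    have N: "average_delay p W \<ge> 1" using nil by (rule average_delay_ge_1)
    have K: "real (card W) \<le> real n ^ l" "real n ^ l > 0"
      using card_uniform_code_le[OF code dec l] assms(2) by (simp_all flip: of_nat_power)
    have "p j ^ Suc D * word_prob p [] \<le> atypical_mass (real n ^ l) e []"
      \<comment> \<open>The condition on code words is vacuous at the root, since \<open>[]\<close>
        is not one.\<close>
      using nil by (intro atypical_mass_lower[OF i(1) j(1) i(2) j(2) e K(2) D root]) auto
    then have "d * p j ^ Suc D \<le> d * atypical_mass (real n ^ l) e []"
      using d(1) by (simp add: word_prob_def)
    also have "\<dots> \<le> (\<Sum>A\<in>W. word_prob p A * ln (word_prob p A * real n ^ l))"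
      using K d(2) by (rule sum_ln_ge_atypical_mass)
    finally have "c \<le> (\<Sum>A\<in>W. word_prob p A * ln (word_prob p A * real n ^ l)) / ln (real n)"
      unfolding c_def using n by (intro divide_right_mono) auto
    then have "c * inverse (average_delay p W) \<le>
        (\<Sum>A\<in>W. word_prob p A * ln (word_prob p A * real n ^ l)) / ln (real n)
          * inverse (average_delay p W)"
      using N by (intro mult_right_mono) auto
    also have "\<dots> = redundancy m n p W \<phi>"
      using N assms(2) l by (intro redundancy_uniform[symmetric]) auto
    finally show ?thesis .
  qed
  moreover have "c > 0" unfolding c_def using d(1) pos n by simp
  ultimately show ?thesis by blast
qed

end
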